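(* For every $p_0\in[1,\infty)$ there exist constants $t_0=t_0(p_0)\in(0,1)$ and $b_0=b_0(p_0)>1$ such that for all $p\in[1,p_0]$, all $t\in[t_0,1)$ and all $d\in\mathbb N\setminus\{0\}$, $$C_{p,d,t}\ \ge\ c_{p,d,t}\ \ge\ \frac{b_0^{(1-t)d}}{6}.$$
   Context: For $t\in(0,1)$ and $d\in\mathbb N\setminus\{0\}$, $\mu_{t,d}$ is the measure on $\mathbb R^d$ given by $d\mu_{t,d}=\|x\|_2^{-td}\,dx$, where $dx$ is Lebesgue measure and $\|\cdot\|_2$ the euclidean norm. $B(x,r)$ denotes the closed euclidean ball of center $x$ and radius $r$. For a locally finite nontrivial Borel measure $\mu$ on $\mathbb R^d$ and locally integrable $g$, the centered Hardy–Littlewood maximal function is $$M_\mu g(x)=\sup_{\{r>0:\mu(B(x,r))>0\}}\frac1{\mu(B(x,r))}\int_{B(x,r)}|g|\,d\mu .$$ For $1\le p<\infty$, $c_{p,d,t}$ is the smallest constant $c$ such that, with $\mu=\mu_{t,d}$, $\mu(\{M_\mu g\ge\alpha\})\le (c\|g\|_{L^p(\mu)}/\alpha)^p$ for all $g\in L^p(\mathbb R^d,\mu)$ and all $\alpha>0$ (weak type $(p,p)$); $C_{p,d,t}\in[0,\infty]$ is the smallest constant $C$ such that $\|M_\mu g\|_{L^p(\mu)}\le C\|g\|_{L^p(\mu)}$ for all $g\in L^p(\mathbb R^d,\mu)$ (strong type $(p,p)$; $C_{p,d,t}=\infty$ if there is no finite constant). *)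

theory Defs
  imports "HOL-Analysis.Analysis"
begin

(* The dimension d is quantified inside the theorem, so R^d is modelled as the space
   {..<d} ->\<^sub>E UNIV of the d-fold product measure of the one-dimensional Lebesgue measure;
   its measurable sets are the Borel sets of R^d. *)

definition lebesgue_Rd :: "nat \<Rightarrow> (nat \<Rightarrow> real) measure" where
  "lebesgue_Rd d = (\<Pi>\<^sub>M i\<in>{..<d}. lborel)"

definition norm_Rd :: "nat \<Rightarrow> (nat \<Rightarrow> real) \<Rightarrow> real" where
  "norm_Rd d x = L2_set x {..<d}"

definition cball_Rd :: "nat \<Rightarrow> (nat \<Rightarrow> real) \<Rightarrow> real \<Rightarrow> (nat \<Rightarrow> real) set" where
  "cball_Rd d x r = {y \<in> space (lebesgue_Rd d). norm_Rd d (\<lambda>i. y i - x i) \<le> r}"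

(* At the origin powr gives the density the value 0; this changes it on a null set only (d > 0). *)
definition mu :: "real \<Rightarrow> nat \<Rightarrow> (nat \<Rightarrow> real) measure" where
  "mu t d = density (lebesgue_Rd d) (\<lambda>x. ennreal (norm_Rd d x powr (- (t * real d))))"

definition maximal_function ::
    "nat \<Rightarrow> (nat \<Rightarrow> real) measure \<Rightarrow> ((nat \<Rightarrow> real) \<Rightarrow> real) \<Rightarrow> (nat \<Rightarrow> real) \<Rightarrow> ennreal" where
  "maximal_function d M g x =
     (SUP r\<in>{r. 0 < r \<and> 0 < emeasure M (cball_Rd d x r)}.
        (\<integral>\<^sup>+y\<in>cball_Rd d x r. ennreal \<bar>g y\<bar> \<partial>M) / emeasure M (cball_Rd d x r))"

(* Real powers on [0,\<infinity>], only used for exponents p > 0. *)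
definition ennreal_powr :: "ennreal \<Rightarrow> real \<Rightarrow> ennreal" where
  "ennreal_powr a p = (if a = top then top else ennreal (enn2real a powr p))"

definition Lp_norm :: "real \<Rightarrow> 'a measure \<Rightarrow> ('a \<Rightarrow> ennreal) \<Rightarrow> ennreal" where
  "Lp_norm p M f = ennreal_powr (\<integral>\<^sup>+x. ennreal_powr (f x) p \<partial>M) (1 / p)"

definition Lp_space :: "real \<Rightarrow> 'a measure \<Rightarrow> ('a \<Rightarrow> real) set" where
  "Lp_space p M = {g \<in> borel_measurable M. Lp_norm p M (\<lambda>x. ennreal \<bar>g x\<bar>) < top}"

definition weak_type :: "real \<Rightarrow> nat \<Rightarrow> (nat \<Rightarrow> real) measure \<Rightarrow> ennreal \<Rightarrow> bool" where
  "weak_type p d M c \<longleftrightarrow>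
     (\<forall>g\<in>Lp_space p M. \<forall>\<alpha>::real. 0 < \<alpha> \<longrightarrow>
        emeasure M {x \<in> space M. ennreal \<alpha> \<le> maximal_function d M g x}
          \<le> ennreal_powr (c * Lp_norm p M (\<lambda>x. ennreal \<bar>g x\<bar>) / ennreal \<alpha>) p)"

definition strong_type :: "real \<Rightarrow> nat \<Rightarrow> (nat \<Rightarrow> real) measure \<Rightarrow> ennreal \<Rightarrow> bool" where
  "strong_type p d M C \<longleftrightarrow>
     (\<forall>g\<in>Lp_space p M.
        Lp_norm p M (maximal_function d M g) \<le> C * Lp_norm p M (\<lambda>x. ennreal \<bar>g x\<bar>))"

(* The infimum in [0,\<infinity>] over finite constants; it is \<infinity> if there is none. *)
definition weak_const :: "real \<Rightarrow> nat \<Rightarrow> real \<Rightarrow> ennreal" where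
  "weak_const p d t = Inf {c. c < top \<and> weak_type p d (mu t d) c}"

definition strong_const :: "real \<Rightarrow> nat \<Rightarrow> real \<Rightarrow> ennreal" where
  "strong_const p d t = Inf {C. C < top \<and> strong_type p d (mu t d) C}"

end

theory Submission
  imports Defs
begin

text \<open>
  The inequality between the two constants is the Markov inequality: a finite strong type constant
  is also a weak type constant. Only the lower bound for the weak type constant needs an idea.
  
  Write $D = (1-t)d$. By homogeneity $\mu(B(0,s)) = s^D \mu(B(0,1))$, where $0 < \mu(B(0,1)) < \infty$.
  The test function is the indicator $g$ of $B(0,1)$. For a point $x$ with $|x| \le R$ consider the
  ball $E = B(x,\sqrt{1+|x|^2})$. By reflection symmetry it contains at least half of the measure
  of the unit ball. On the other hand its measure is at most $2 \cdot 2^D \mu(B(0,1))$, however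
  large $R$ is, provided that $t$ is close enough to $1$: a point $y \in E$ with $|y| \ge 2$ is
  brought closer to the origin by a factor $q < 1$ that depends only on $R$ if a suitable multiple of
  $x$ is subtracted from it. Translations preserve the volume, and the density $|y|^{-td}$
  increases by the factor $q^{-td}$ at least, so that part of $E$ has measure at most
  $q^{td}\mu(B(0,3R)) = q^{td}(3R)^D\mu(B(0,1))$. This is at most $\mu(B(0,1))$ for all $d$ at once
  when $q^t(3R)^{1-t} \le 1$.
  
  Hence $M_\mu g \ge 2^{-D}/4$ on all of $B(0,R)$, and the weak type inequality gives
  $c \ge R^{D/p}\, 2^{-D}/4$. With $R = 4^{p_0}$ the right-hand side is at least $2^D/4$ for all
  $p \le p_0$, so $b_0 = 2$ is a possible choice.
  
  The geometric step is \<open>shift_contracts_off_centre\<close>, its consequence for the measure of $E$ is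
  \<open>off_centre_ball_small\<close>, and the estimate of the constant is \<open>weak_type_constant_ge\<close>. Passing from a
  pointwise lower bound for $M_\mu g$ to a lower bound for the measure of a level set requires that
  the level set is measurable, which is \<open>borel_measurable_maximal_function\<close>.
\<close>

section \<open>Euclidean geometry\<close>

lemma norm_Rd_sq: "(norm_Rd d x)^2 = (\<Sum>i<d. (x i)^2)"
  unfolding norm_Rd_def L2_set_def by (simp add: sum_nonneg)

lemma norm_Rd_nonneg [simp]: "0 \<le> norm_Rd d x"
  unfolding norm_Rd_def by (simp add: L2_set_nonneg)

lemma norm_Rd_cong: "(\<And>i. i < d \<Longrightarrow> x i = y i) \<Longrightarrow> norm_Rd d x = norm_Rd d y"
  unfolding norm_Rd_def by (rule L2_set_cong) auto

lemma norm_Rd_restrict [simp]: "norm_Rd d (restrict x {..<d}) = norm_Rd d x"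
  by (rule norm_Rd_cong) simp

lemma norm_Rd_scale: "norm_Rd d (\<lambda>i. c * x i) = \<bar>c\<bar> * norm_Rd d x"
  unfolding norm_Rd_def L2_set_def
  by (simp add: power_mult_distrib flip: sum_distrib_left) (simp add: real_sqrt_mult)

lemma norm_Rd_add: "norm_Rd d (\<lambda>i. x i + y i) \<le> norm_Rd d x + norm_Rd d y"
  unfolding norm_Rd_def by (rule L2_set_triangle_ineq)

lemma norm_Rd_le_diff_add: "norm_Rd d y \<le> norm_Rd d (\<lambda>i. y i - x i) + norm_Rd d x"
  using norm_Rd_add[of d "\<lambda>i. y i - x i" x] by simp

lemma norm_Rd_diff_scaled_sq:
  "(norm_Rd d (\<lambda>i. y i - s * x i))^2
     = (norm_Rd d y)^2 - 2 * s * (\<Sum>i<d. x i * y i) + s^2 * (norm_Rd d x)^2"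
  unfolding norm_Rd_sq
  by (simp add: power2_diff power_mult_distrib sum.distrib sum_subtractf sum_distrib_left mult_ac)

lemma norm_Rd_diff_sq:
  "(norm_Rd d (\<lambda>i. y i - x i))^2
     = (norm_Rd d y)^2 - 2 * (\<Sum>i<d. x i * y i) + (norm_Rd d x)^2"
  using norm_Rd_diff_scaled_sq[of d y 1 x] by simp

text \<open>
  The geometric core. A point $y$ of the ball $B(x,\sqrt{1+|x|^2})$ satisfies
  $2\langle x,y\rangle \ge |y|^2-1$, so once $|y| \ge 2$ it leans towards $x$, and subtracting a
  multiple $s x$ shortens it:
  $|y-sx|^2 \le |y|^2 - s(|y|^2-1) + s^2|x|^2$. With $s|x|^2 \le 1$ and $|y|^2 \ge 4$ the gain is at
  least $s|y|^2/2$, and $s \ge 1/R^2$, so the contraction factor depends only on $R$ and not on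
  the dimension. The bound $s|x| \le 1$ keeps $y-sx$ away from the origin.
\<close>

lemma shift_contracts_off_centre:
  assumes ball: "norm_Rd d (\<lambda>i. y i - x i) \<le> sqrt (1 + (norm_Rd d x)^2)"
    and far: "2 \<le> norm_Rd d y" and xR: "norm_Rd d x \<le> R" and R: "1 \<le> R"
  defines "s \<equiv> (if norm_Rd d x \<le> 1 then 1 else 1 / (norm_Rd d x)^2)"
  shows "norm_Rd d (\<lambda>i. y i - s * x i) \<le> sqrt (1 - 1 / (2 * R^2)) * norm_Rd d y"
    and "s * norm_Rd d x \<le> 1" and "0 \<le> s"
proof -
  define a Y where "a = norm_Rd d x" and "Y = norm_Rd d y"
  have a0: "0 \<le> a" and Y: "2 \<le> Y" and aR: "a \<le> R" using far xR by (simp_all add: a_def Y_def)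
  have s_eq: "s = (if a \<le> 1 then 1 else 1 / a^2)" by (simp add: s_def a_def)
  show s0: "0 \<le> s" by (simp add: s_eq)
  have "s * a \<le> 1"
    by (auto simp: s_eq power2_eq_square divide_simps)
  then show "s * norm_Rd d x \<le> 1" by (simp add: a_def)
  have s1: "s \<le> 1" by (auto simp: s_eq divide_simps)
  have sa: "s * a^2 \<le> 1" using a0 by (auto simp: s_eq power_le_one)
  have sR: "1 / R^2 \<le> s"
  proof (cases "a \<le> 1")
    case True then show ?thesis using R by (simp add: s_eq divide_simps one_le_power)
  next
    case False
    then have "a^2 \<le> R^2" using aR by (intro power_mono) auto
    then show ?thesis using False by (simp add: s_eq frac_le)
  qed
  have "(norm_Rd d (\<lambda>i. y i - x i))^2 \<le> (sqrt (1 + a^2))^2"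
    using ball unfolding a_def by (intro power_mono) auto
  then have "(norm_Rd d (\<lambda>i. y i - x i))^2 \<le> 1 + a^2" by simp
  then have ip: "Y^2 - 1 \<le> 2 * (\<Sum>i<d. x i * y i)"
    by (simp add: norm_Rd_diff_sq a_def Y_def)
  have "s * (Y^2 - 1) \<le> s * (2 * (\<Sum>i<d. x i * y i))" using ip s0 by (rule mult_left_mono)
  then have 1: "(norm_Rd d (\<lambda>i. y i - s * x i))^2 \<le> Y^2 - s * (Y^2 - 1) + s * (s * a^2)"
    unfolding norm_Rd_diff_scaled_sq a_def Y_def by (simp add: power2_eq_square mult_ac)
  have "s * (s * a^2) \<le> s * 1" using sa s0 by (rule mult_left_mono)
  have "4 \<le> Y^2" using power_mono[OF Y, of 2] by simp
  then have "s * 4 \<le> s * Y^2" using s0 by (rule mult_left_mono)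
  have "(1 / R^2) * Y^2 \<le> s * Y^2" using sR by (rule mult_right_mono) simp
  then have "(norm_Rd d (\<lambda>i. y i - s * x i))^2 \<le> (1 - 1 / (2 * R^2)) * Y^2"
    using 1 \<open>s * (s * a^2) \<le> s * 1\<close> \<open>s * 4 \<le> s * Y^2\<close> by (simp add: algebra_simps)
  then show "norm_Rd d (\<lambda>i. y i - s * x i) \<le> sqrt (1 - 1 / (2 * R^2)) * norm_Rd d y"
    using Y by (metis Y_def norm_Rd_nonneg real_le_rsqrt real_sqrt_mult real_sqrt_abs abs_of_nonneg)
qed

section \<open>Lebesgue measure on the product space\<close>

lemma space_lebesgue_Rd: "space (lebesgue_Rd d) = {..<d} \<rightarrow>\<^sub>E UNIV"
  by (simp add: lebesgue_Rd_def space_PiM)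

lemma measurable_coord [measurable]:
  "i < d \<Longrightarrow> (\<lambda>x. x i) \<in> borel_measurable (lebesgue_Rd d)"
  unfolding lebesgue_Rd_def
  using measurable_component_singleton[of i "{..<d}" "\<lambda>_. lborel"] by simp

lemma measurable_norm_Rd [measurable]:
  assumes "\<And>i. i < d \<Longrightarrow> (\<lambda>x. f x i) \<in> borel_measurable M"
  shows "(\<lambda>x. norm_Rd d (f x)) \<in> borel_measurable M"
  unfolding norm_Rd_def L2_set_def using assms by measurable

lemma measurable_affine_Rd [measurable]:
  "(\<lambda>y. \<lambda>i\<in>{..<d}. v i + c * y i) \<in> measurable (lebesgue_Rd d) (lebesgue_Rd d)"
proof -
  have "(\<lambda>y. v i + c * y i) \<in> measurable (lebesgue_Rd d) lborel" if "i < d" for i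
    using measurable_coord[OF that] by simp
  then show ?thesis
    by (subst (2) lebesgue_Rd_def) (auto intro!: measurable_restrict)
qed

lemma sets_cball_Rd [measurable]: "cball_Rd d x r \<in> sets (lebesgue_Rd d)"
  unfolding cball_Rd_def by measurable

text \<open>
  Translations, dilations and the reflection in the origin all occur below, so the affine
  substitution is treated once. It is enough to compare both measures on boxes, where the
  claim is the one-dimensional substitution rule in each coordinate.
\<close>

lemma lebesgue_Rd_affine:
  assumes "c \<noteq> 0"
  shows "lebesgue_Rd d = density (distr (lebesgue_Rd d) (lebesgue_Rd d)
     (\<lambda>y. \<lambda>i\<in>{..<d}. v i + c * y i)) (\<lambda>_. ennreal (\<bar>c\<bar>^d))" (is "_ = ?P")
proof -
  interpret product_sigma_finite "\<lambda>i::nat. lborel :: real measure" ..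
  have "(\<Pi>\<^sub>M i\<in>{..<d}. lborel) = ?P"
  proof (rule PiM_eqI[symmetric])
    show "sets ?P = sets (\<Pi>\<^sub>M i\<in>{..<d}. lborel :: real measure)"
      by (simp add: lebesgue_Rd_def)
  next
    fix A :: "nat \<Rightarrow> real set" assume A: "\<And>i. i \<in> {..<d} \<Longrightarrow> A i \<in> sets lborel"
    let ?T = "\<lambda>y. \<lambda>i\<in>{..<d}. v i + c * y i"
    let ?A' = "\<lambda>i. (\<lambda>z. v i + c * z) -` A i"
    have A': "?A' i \<in> sets lborel" if "i < d" for i
      using measurable_sets[of "\<lambda>z. v i + c * z" lborel lborel "A i"] A[of i] that by simp
    have PA [measurable]: "Pi\<^sub>E {..<d} A \<in> sets (lebesgue_Rd d)"
      unfolding lebesgue_Rd_def using A by (intro sets_PiM_I_finite) auto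
    have lb: "ennreal \<bar>c\<bar> * emeasure lborel (?A' i) = emeasure lborel (A i)" if "i < d" for i
    proof -
      have "emeasure lborel (A i) = emeasure (density (distr lborel borel (\<lambda>z. v i + c * z)) (\<lambda>_. ennreal \<bar>c\<bar>)) (A i)"
        using lborel_real_affine[OF assms, of "v i"] by simp
      also have "\<dots> = ennreal \<bar>c\<bar> * emeasure lborel (?A' i)"
        using A[of i] that by (simp add: emeasure_density_const emeasure_distr)
      finally show ?thesis by simp
    qed
    have "emeasure ?P (Pi\<^sub>E {..<d} A) = ennreal (\<bar>c\<bar>^d) * emeasure (lebesgue_Rd d) (?T -` Pi\<^sub>E {..<d} A \<inter> space (lebesgue_Rd d))"
      by (simp add: emeasure_density_const emeasure_distr)
    also have "?T -` Pi\<^sub>E {..<d} A \<inter> space (lebesgue_Rd d) = Pi\<^sub>E {..<d} ?A'"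
      by (auto simp: space_lebesgue_Rd PiE_iff extensional_def)
    also have "emeasure (lebesgue_Rd d) (Pi\<^sub>E {..<d} ?A') = (\<Prod>i<d. emeasure lborel (?A' i))"
      unfolding lebesgue_Rd_def using A' by (intro emeasure_PiM) auto
    also have "ennreal (\<bar>c\<bar>^d) * \<dots> = (\<Prod>i<d. ennreal \<bar>c\<bar> * emeasure lborel (?A' i))"
      by (simp add: prod.distrib ennreal_power)
    also have "\<dots> = (\<Prod>i<d. emeasure lborel (A i))" using lb by (intro prod.cong) auto
    finally show "emeasure ?P (Pi\<^sub>E {..<d} A) = (\<Prod>i\<in>{..<d}. emeasure lborel (A i))" .
  qed simp
  then show ?thesis by (simp add: lebesgue_Rd_def)
qed

lemma nn_integral_lebesgue_Rd_affine:
  assumes "c \<noteq> 0" and [measurable]: "f \<in> borel_measurable (lebesgue_Rd d)"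
  shows "(\<integral>\<^sup>+y. f y \<partial>lebesgue_Rd d)
    = ennreal (\<bar>c\<bar>^d) * (\<integral>\<^sup>+y. f (\<lambda>i\<in>{..<d}. v i + c * y i) \<partial>lebesgue_Rd d)"
  by (subst lebesgue_Rd_affine[OF assms(1), of d v])
     (simp add: nn_integral_density nn_integral_distr nn_integral_cmult)

section \<open>The radial measures\<close>

lemma sets_mu [simp, measurable_cong]: "sets (mu t d) = sets (lebesgue_Rd d)"
  by (simp add: mu_def)

lemma space_mu [simp]: "space (mu t d) = space (lebesgue_Rd d)"
  by (simp add: mu_def)

lemma emeasure_mu:
  "A \<in> sets (lebesgue_Rd d) \<Longrightarrow> emeasure (mu t d) A
    = (\<integral>\<^sup>+y. ennreal (norm_Rd d y powr (- (t * real d))) * indicator A y \<partial>lebesgue_Rd d)"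
  unfolding mu_def by (rule emeasure_density) measurable

abbreviation cball0 :: "nat \<Rightarrow> real \<Rightarrow> (nat \<Rightarrow> real) set" where
  "cball0 d r \<equiv> cball_Rd d (\<lambda>_. 0) r"

text \<open>
  Both the volume element and the density are homogeneous, of degrees $d$ and $-td$. The case
  $s=-1$ is the invariance under reflection.
\<close>

lemma emeasure_mu_scale:
  assumes s: "s \<noteq> 0" and A [measurable]: "A \<in> sets (lebesgue_Rd d)"
  shows "emeasure (mu t d) A = ennreal (\<bar>s\<bar> powr ((1 - t) * real d)) *
     emeasure (mu t d) {y \<in> space (lebesgue_Rd d). (\<lambda>i\<in>{..<d}. s * y i) \<in> A}"
proof -
  have [measurable]: "(\<lambda>y. \<lambda>i\<in>{..<d}. s * y i) \<in> measurable (lebesgue_Rd d) (lebesgue_Rd d)"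
    using measurable_affine_Rd[where v = "\<lambda>_. 0" and c = s and d = d] by simp
  let ?B = "{y \<in> space (lebesgue_Rd d). (\<lambda>i\<in>{..<d}. s * y i) \<in> A}"
  have B [measurable]: "?B \<in> sets (lebesgue_Rd d)" by measurable
  have "emeasure (mu t d) A = ennreal (\<bar>s\<bar>^d) *
    (\<integral>\<^sup>+y. ennreal (norm_Rd d (\<lambda>i\<in>{..<d}. s * y i) powr (- (t * real d))) * indicator A (\<lambda>i\<in>{..<d}. s * y i) \<partial>lebesgue_Rd d)"
    unfolding emeasure_mu[OF A]
    by (subst nn_integral_lebesgue_Rd_affine[OF s, where v = "\<lambda>_. 0"]) auto
  also have "(\<integral>\<^sup>+y. ennreal (norm_Rd d (\<lambda>i\<in>{..<d}. s * y i) powr (- (t * real d))) * indicator A (\<lambda>i\<in>{..<d}. s * y i) \<partial>lebesgue_Rd d)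
    = (\<integral>\<^sup>+y. ennreal (\<bar>s\<bar> powr (- (t * real d))) * (ennreal (norm_Rd d y powr (- (t * real d))) * indicator ?B y) \<partial>lebesgue_Rd d)"
    by (intro nn_integral_cong)
       (auto simp: norm_Rd_scale powr_mult ennreal_mult' indicator_def)
  also have "\<dots> = ennreal (\<bar>s\<bar> powr (- (t * real d))) * emeasure (mu t d) ?B"
    by (subst nn_integral_cmult) (auto simp: emeasure_mu)
  also have "ennreal (\<bar>s\<bar>^d) * \<dots> = ennreal (\<bar>s\<bar>^d * \<bar>s\<bar> powr (- (t * real d))) * emeasure (mu t d) ?B"
    by (simp add: ennreal_mult' mult.assoc)
  also have "\<bar>s\<bar>^d * \<bar>s\<bar> powr (- (t * real d)) = \<bar>s\<bar> powr ((1 - t) * real d)"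
    using s by (simp add: powr_realpow[symmetric] powr_add[symmetric] algebra_simps)
  finally show ?thesis .
qed

lemma scaled_mem_space: "(\<lambda>i\<in>{..<d}. f i) \<in> space (lebesgue_Rd d)"
  by (simp add: space_lebesgue_Rd)

lemma emeasure_mu_cball0:
  assumes "0 < s"
  shows "emeasure (mu t d) (cball0 d s)
    = ennreal (s powr ((1 - t) * real d)) * emeasure (mu t d) (cball0 d 1)"
proof -
  have "{y \<in> space (lebesgue_Rd d). (\<lambda>i\<in>{..<d}. s * y i) \<in> cball0 d s} = cball0 d 1"
    using assms by (auto simp: cball_Rd_def scaled_mem_space norm_Rd_scale)
  then show ?thesis using emeasure_mu_scale[of s "cball0 d s" d t] assms by simp
qed

text \<open>
  Translation preserves the volume, so a translation that brings every point of $A$ closer to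
  the origin by a factor $q$ increases the density by at least $q^{-td}$. For $t$ close to $1$
  this exponent is far larger than the degree $(1-t)d$ with which the measure of balls grows.
  Points of $A$ must not be moved to the origin because there the density has the value $0$.
\<close>

lemma emeasure_mu_translate_le:
  assumes "t > 0" and A [measurable]: "A \<in> sets (lebesgue_Rd d)" and q: "0 < q"
    and contr: "\<And>y. y \<in> A \<Longrightarrow> norm_Rd d (\<lambda>i. y i - v i) \<le> q * norm_Rd d y"
    and nz: "\<And>y. y \<in> A \<Longrightarrow> 0 < norm_Rd d (\<lambda>i. y i - v i)"
    and r: "\<And>y. y \<in> A \<Longrightarrow> norm_Rd d (\<lambda>i. y i - v i) \<le> r"
  shows "emeasure (mu t d) A \<le> ennreal (q powr (t * real d)) * emeasure (mu t d) (cball0 d r)"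
proof -
  let ?w = "\<lambda>y. ennreal (norm_Rd d y powr (- (t * real d)))"
  let ?T = "\<lambda>y. \<lambda>i\<in>{..<d}. - v i + 1 * y i"
  have "emeasure (mu t d) A = (\<integral>\<^sup>+y. ?w y * indicator A y \<partial>lebesgue_Rd d)"
    by (rule emeasure_mu) measurable
  also have "\<dots> \<le> (\<integral>\<^sup>+y. ennreal (q powr (t * real d)) * (?w (?T y) * indicator (cball0 d r) (?T y)) \<partial>lebesgue_Rd d)"
  proof (rule nn_integral_mono)
    fix y assume "y \<in> space (lebesgue_Rd d)"
    show "?w y * indicator A y \<le> ennreal (q powr (t * real d)) * (?w (?T y) * indicator (cball0 d r) (?T y))"
    proof (cases "y \<in> A")
      case True
      let ?n = "norm_Rd d (\<lambda>i. y i - v i)"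
      have n: "norm_Rd d (?T y) = ?n" by simp
      then have in_ball: "?T y \<in> cball0 d r" using r[OF True] by (auto simp: cball_Rd_def scaled_mem_space)
      have Y: "0 < norm_Rd d y" using nz[OF True] contr[OF True] q
        by (smt (verit) mult_nonneg_nonpos norm_Rd_nonneg)
      have "norm_Rd d y powr (- (t * real d)) = q powr (t * real d) * (q * norm_Rd d y) powr (- (t * real d))"
        using q Y by (simp add: powr_mult powr_minus)
      also have "\<dots> \<le> q powr (t * real d) * ?n powr (- (t * real d))"
        using contr[OF True] nz[OF True] \<open>t > 0\<close>
        by (intro mult_left_mono powr_mono2') auto
      finally have "ennreal (norm_Rd d y powr (- (t * real d))) \<le> ennreal (q powr (t * real d) * ?n powr (- (t * real d)))"
        by (rule ennreal_leI)
      then show ?thesis using True in_ball unfolding n by (simp add: ennreal_mult')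
    qed simp
  qed
  also have "\<dots> = ennreal (q powr (t * real d)) * (\<integral>\<^sup>+y. ?w (?T y) * indicator (cball0 d r) (?T y) \<partial>lebesgue_Rd d)"
    by (rule nn_integral_cmult) measurable
  also have "(\<integral>\<^sup>+y. ?w (?T y) * indicator (cball0 d r) (?T y) \<partial>lebesgue_Rd d) = emeasure (mu t d) (cball0 d r)"
    unfolding emeasure_mu[OF sets_cball_Rd]
    by (subst nn_integral_lebesgue_Rd_affine[where c = 1 and v = "\<lambda>i. - v i"]) auto
  finally show ?thesis .
qed

section \<open>Balls have finite measure\<close>

lemma cball_Rd_mono: "r \<le> s \<Longrightarrow> cball_Rd d x r \<subseteq> cball_Rd d x s"
  by (auto simp: cball_Rd_def)

lemma cball_Rd_subset_cball0: "cball_Rd d x r \<subseteq> cball0 d (norm_Rd d x + r)"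
proof
  fix y assume "y \<in> cball_Rd d x r"
  then show "y \<in> cball0 d (norm_Rd d x + r)"
    using norm_Rd_le_diff_add[of d y x] by (simp add: cball_Rd_def)
qed

lemma emeasure_lebesgue_cube:
  assumes "a \<le> b"
  shows "emeasure (lebesgue_Rd d) (Pi\<^sub>E {..<d} (\<lambda>_. {a..b})) = ennreal ((b - a)^d)"
    and "Pi\<^sub>E {..<d} (\<lambda>_. {a..b}) \<in> sets (lebesgue_Rd d)"
proof -
  interpret product_sigma_finite "\<lambda>i::nat. lborel :: real measure" ..
  show "emeasure (lebesgue_Rd d) (Pi\<^sub>E {..<d} (\<lambda>_. {a..b})) = ennreal ((b - a)^d)"
    unfolding lebesgue_Rd_def using assms
    by (subst emeasure_PiM) (auto simp: ennreal_power)
  show "Pi\<^sub>E {..<d} (\<lambda>_. {a..b}) \<in> sets (lebesgue_Rd d)"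
    unfolding lebesgue_Rd_def by (intro sets_PiM_I_finite) auto
qed

lemma emeasure_lebesgue_unit_ball_finite: "emeasure (lebesgue_Rd d) (cball0 d 1) < top"
proof -
  have "cball0 d 1 \<subseteq> Pi\<^sub>E {..<d} (\<lambda>_. {-1..1})"
  proof
    fix y assume y: "y \<in> cball0 d 1"
    have "\<bar>y i\<bar> \<le> 1" if "i < d" for i
    proof -
      have "\<bar>y i\<bar> \<le> L2_set (\<lambda>i. \<bar>y i\<bar>) {..<d}"
        using that by (intro member_le_L2_set) auto
      also have "\<dots> = norm_Rd d y" by (simp add: norm_Rd_def L2_set_def)
      also have "\<dots> \<le> 1" using y by (simp add: cball_Rd_def)
      finally show ?thesis .
    qed
    then show "y \<in> Pi\<^sub>E {..<d} (\<lambda>_. {-1..1})"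
      using y by (auto simp: cball_Rd_def space_lebesgue_Rd PiE_iff abs_le_iff)
  qed
  then have "emeasure (lebesgue_Rd d) (cball0 d 1) \<le> emeasure (lebesgue_Rd d) (Pi\<^sub>E {..<d} (\<lambda>_. {-1..1}))"
    using emeasure_lebesgue_cube(2)[of "-1" 1 d] by (intro emeasure_mono) auto
  also have "\<dots> < top" using emeasure_lebesgue_cube(1)[of "-1" 1 d] by (simp add: power_less_top_ennreal)
  finally show ?thesis .
qed

text \<open>
  On the unit ball the density is at least $1$ away from the origin, so any box of positive
  volume that avoids the origin is a witness.
\<close>

lemma emeasure_mu_unit_ball_pos:
  assumes d: "0 < d" and t: "0 < t"
  shows "0 < emeasure (mu t d) (cball0 d 1)"
proof -
  define Q where "Q = Pi\<^sub>E {..<d} (\<lambda>_. {1 / (2 * real d)..1 / real d})"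
  have le: "1 / (2 * real d) \<le> 1 / real d" using d by (simp add: field_simps)
  have Q [measurable]: "Q \<in> sets (lebesgue_Rd d)"
    unfolding Q_def by (rule emeasure_lebesgue_cube(2)[OF le])
  have "1 / real d - 1 / (2 * real d) > 0" using d by (simp add: field_simps)
  then have "0 < emeasure (lebesgue_Rd d) Q"
    unfolding Q_def emeasure_lebesgue_cube(1)[OF le] by simp
  have nQ: "0 < norm_Rd d y \<and> norm_Rd d y \<le> 1" if "y \<in> Q" for y
  proof -
    have yi: "1 / (2 * real d) \<le> y i" "y i \<le> 1 / real d" if "i < d" for i
      using \<open>y \<in> Q\<close> that by (auto simp: Q_def PiE_iff)
    then have yp: "0 < y i" if "i < d" for i
      using yi(1)[OF that] d by (smt (verit) divide_pos_pos of_nat_0_less_iff)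
    have "norm_Rd d y \<le> (\<Sum>i<d. \<bar>y i\<bar>)" unfolding norm_Rd_def by (rule L2_set_le_sum_abs)
    also have "\<dots> \<le> (\<Sum>i<d. 1 / real d)" using yi(2) yp by (intro sum_mono) (simp add: less_imp_le)
    also have "\<dots> = 1" using d by simp
    finally have "norm_Rd d y \<le> 1" .
    moreover have "y 0 \<le> norm_Rd d y" unfolding norm_Rd_def
      using d by (intro member_le_L2_set) auto
    ultimately show ?thesis using yp[OF d] by simp
  qed
  have "emeasure (lebesgue_Rd d) Q = (\<integral>\<^sup>+y. indicator Q y \<partial>lebesgue_Rd d)" by simp
  also have "\<dots> \<le> (\<integral>\<^sup>+y. ennreal (norm_Rd d y powr (- (t * real d))) * indicator Q y \<partial>lebesgue_Rd d)"
  proof (rule nn_integral_mono)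
    fix y
    have "1 \<le> norm_Rd d y powr (- (t * real d))" if "y \<in> Q"
      using powr_mono2'[of "- (t * real d)" "norm_Rd d y" 1] nQ[OF that] t by simp
    then show "indicator Q y \<le> ennreal (norm_Rd d y powr (- (t * real d))) * indicator Q y"
      by (auto simp: indicator_def)
  qed
  also have "\<dots> = emeasure (mu t d) Q" by (simp add: emeasure_mu)
  also have "\<dots> \<le> emeasure (mu t d) (cball0 d 1)"
  proof (rule emeasure_mono)
    show "Q \<subseteq> cball0 d 1"
      using nQ sets.sets_into_space[OF Q] by (auto simp: cball_Rd_def)
  qed simp
  finally show ?thesis using \<open>0 < emeasure (lebesgue_Rd d) Q\<close> by simp
qed

text \<open>
  The unit ball is the union of the dyadic annuli $2^{-k-1} < |y| \le 2^{-k}$ and a null set. On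
  one annulus the density is bounded; by scaling the measures of the annuli form a geometric
  series with ratio $2^{-(1-t)d} < 1$.
\<close>

lemma emeasure_mu_unit_ball_finite:
  assumes d: "0 < d" and t: "0 < t" "t < 1"
  shows "emeasure (mu t d) (cball0 d 1) < top"
proof -
  let ?L = "lebesgue_Rd d" and ?M = "mu t d"
  define A where "A k = {y \<in> space ?L. (1/2)^Suc k < norm_Rd d y \<and> norm_Rd d y \<le> (1/2)^k}" for k
  define Z where "Z = {y \<in> space ?L. norm_Rd d y = 0}"
  have A [measurable]: "A k \<in> sets ?L" for k unfolding A_def by measurable
  have Z [measurable]: "Z \<in> sets ?L" unfolding Z_def by measurable
  \<comment> \<open>The density vanishes at the origin.\<close>
  have Z0: "emeasure ?M Z = 0"
  proof -
    have "emeasure ?M Z = (\<integral>\<^sup>+y. 0 \<partial>?L)" unfolding emeasure_mu[OF Z]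
      by (intro nn_integral_cong) (auto simp: Z_def indicator_def)
    then show ?thesis by simp
  qed
  have A0: "emeasure ?M (A 0) < top"
  proof -
    have "emeasure ?M (A 0) \<le> (\<integral>\<^sup>+y. ennreal ((1/2) powr (- (t * real d))) * indicator (cball0 d 1) y \<partial>?L)"
      unfolding emeasure_mu[OF A]
    proof (rule nn_integral_mono)
      fix y assume y: "y \<in> space ?L"
      have "norm_Rd d y powr (- (t * real d)) \<le> (1/2) powr (- (t * real d))" if "y \<in> A 0"
        using that t by (intro powr_mono2') (auto simp: A_def)
      then show "ennreal (norm_Rd d y powr (- (t * real d))) * indicator (A 0) y
          \<le> ennreal ((1/2) powr (- (t * real d))) * indicator (cball0 d 1) y"
        by (auto simp: indicator_def A_def cball_Rd_def intro: ennreal_leI)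
    qed
    also have "\<dots> = ennreal ((1/2) powr (- (t * real d))) * emeasure ?L (cball0 d 1)"
      by (simp add: nn_integral_cmult_indicator)
    also have "\<dots> < top" using emeasure_lebesgue_unit_ball_finite[of d]
      by (simp add: ennreal_mult_less_top)
    finally show ?thesis .
  qed
  define w where "w = (1/2 :: real) powr ((1 - t) * real d)"
  have w: "0 < w" "w < 1" using t d powr_less_mono2_neg[of "- ((1 - t) * real d)" 1 2]
    by (auto simp: w_def powr_divide powr_minus divide_simps)
  have Ak: "emeasure ?M (A k) = ennreal (w^k) * emeasure ?M (A 0)" for k
  proof -
    have "{y \<in> space ?L. (\<lambda>i\<in>{..<d}. (1/2)^k * y i) \<in> A k} = A 0"
      using norm_Rd_scale[of d "(1/2)^k"]
      by (auto simp del: power_one_over simp: A_def scaled_mem_space)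
    moreover have "((1/2)^k) powr ((1 - t) * real d) = w^k"
      by (simp add: w_def powr_power powr_powr mult_ac flip: powr_realpow)
    ultimately show ?thesis using emeasure_mu_scale[of "(1/2)^k" "A k" d t] by simp
  qed
  have "cball0 d 1 \<subseteq> Z \<union> (\<Union>k. A k)"
  proof
    fix y assume y: "y \<in> cball0 d 1"
    show "y \<in> Z \<union> (\<Union>k. A k)"
    proof (cases "norm_Rd d y = 0")
      case True then show ?thesis using y by (auto simp: Z_def cball_Rd_def)
    next
      case False
      then have "0 < norm_Rd d y" by (simp add: less_le)
      then obtain n where n: "(1/2)^n < norm_Rd d y" using real_arch_pow_inv[of "norm_Rd d y" "1/2"] by auto
      define k where "k = (LEAST k. (1/2)^Suc k < norm_Rd d y)"
      have "(1/2)^Suc n < norm_Rd d y" using n \<open>0 < norm_Rd d y\<close> by simp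
      then have k: "(1/2)^Suc k < norm_Rd d y" unfolding k_def by (rule LeastI)
      have "norm_Rd d y \<le> (1/2)^k"
      proof (cases k)
        case 0 then show ?thesis using y by (simp add: cball_Rd_def)
      next
        case (Suc j)
        then have "\<not> (1/2)^Suc j < norm_Rd d y" unfolding k_def by (intro not_less_Least) simp
        then show ?thesis using Suc by simp
      qed
      then show ?thesis using k y by (auto simp: A_def cball_Rd_def)
    qed
  qed
  then have "emeasure ?M (cball0 d 1) \<le> emeasure ?M (Z \<union> (\<Union>k. A k))"
    by (intro emeasure_mono) auto
  also have "\<dots> \<le> emeasure ?M Z + emeasure ?M (\<Union>k. A k)"
    by (intro emeasure_subadditive) auto
  also have "\<dots> \<le> (\<Sum>k. emeasure ?M (A k))"
    unfolding Z0 by (simp, intro emeasure_subadditive_countably) auto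
  also have "\<dots> = (\<Sum>k. ennreal (w^k)) * emeasure ?M (A 0)"
    by (subst ennreal_suminf_multc[symmetric], rule suminf_cong, rule Ak)
  also have "(\<Sum>k. ennreal (w^k)) = ennreal (1 / (1 - w))"
    using w by (intro suminf_ennreal_eq geometric_sums) auto
  also have "ennreal (1 / (1 - w)) * emeasure ?M (A 0) < top"
    using A0 by (simp add: ennreal_mult_less_top)
  finally show ?thesis .
qed

lemma emeasure_mu_cball_finite:
  assumes "0 < d" "0 < t" "t < 1"
  shows "emeasure (mu t d) (cball_Rd d x r) < top"
proof -
  let ?s = "1 + \<bar>norm_Rd d x + r\<bar>"
  have "cball_Rd d x r \<subseteq> cball0 d ?s"
    using cball_Rd_subset_cball0[of d x r] cball_Rd_mono[of "norm_Rd d x + r" ?s d "\<lambda>_. 0"] by fastforce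
  then have "emeasure (mu t d) (cball_Rd d x r) \<le> emeasure (mu t d) (cball0 d ?s)"
    by (intro emeasure_mono) auto
  also have "\<dots> = ennreal (?s powr ((1 - t) * real d)) * emeasure (mu t d) (cball0 d 1)"
    by (rule emeasure_mu_cball0) simp
  also have "\<dots> < top"
    using emeasure_mu_unit_ball_finite[OF assms] by (simp add: ennreal_mult_less_top)
  finally show ?thesis .
qed

section \<open>Measurability of the maximal function\<close>

lemma sigma_finite_if_balls_finite:
  assumes sets: "sets M = sets (lebesgue_Rd d)"
    and fin: "\<And>r. emeasure M (cball0 d r) < top"
  shows "sigma_finite_measure M"
proof
  show "\<exists>A. countable A \<and> A \<subseteq> sets M \<and> \<Union> A = space M \<and> (\<forall>a\<in>A. emeasure M a \<noteq> \<infinity>)"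
  proof (intro exI[of _ "range (\<lambda>n::nat. cball0 d (real n))"] conjI)
    show "\<Union> (range (\<lambda>n::nat. cball0 d (real n))) = space M"
      using real_arch_simple sets_eq_imp_space_eq[OF sets] by (auto simp: cball_Rd_def)
  qed (use sets fin in \<open>auto simp: less_top\<close>)
qed

text \<open>
  The measure of a closed ball is continuous from the right in the radius, so the mean over
  $B(x,r)$ is dominated by the means over the slightly larger balls of rational radius.
\<close>

lemma maximal_function_eq_SUP_rat:
  assumes sets: "sets M = sets (lebesgue_Rd d)"
    and fin: "\<And>r. emeasure M (cball_Rd d x r) < top"
  shows "maximal_function d M g x = (SUP q\<in>{q\<in>\<rat>. 0 < q}.
     if 0 < emeasure M (cball_Rd d x q) then
       (\<integral>\<^sup>+y\<in>cball_Rd d x q. ennreal \<bar>g y\<bar> \<partial>M) / emeasure M (cball_Rd d x q) else 0)"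
  (is "_ = ?S")
proof (rule antisym)
  let ?V = "\<lambda>r. emeasure M (cball_Rd d x r)" and ?F = "\<lambda>r. \<integral>\<^sup>+y\<in>cball_Rd d x r. ennreal \<bar>g y\<bar> \<partial>M"
  have V_mono: "?V r \<le> ?V s" if "r \<le> s" for r s
    using cball_Rd_mono[OF that] by (intro emeasure_mono) (auto simp: sets)
  have F_mono: "?F r \<le> ?F s" if "r \<le> s" for r s
    using cball_Rd_mono[OF that, of d x] by (intro nn_integral_mono) (auto simp: indicator_def)
  show "maximal_function d M g x \<le> ?S"
    unfolding maximal_function_def
  proof (rule SUP_least)
    fix r assume "r \<in> {r. 0 < r \<and> 0 < ?V r}"
    then have r: "0 < r" "0 < ?V r" by auto
    define S where "S = ?S"
    have "?F r / ?V r \<le> S"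
    proof (cases "S = top")
      case False
      then have S: "S < top" by (simp add: less_top)
      \<comment> \<open>The inequality is kept free of quotients so that the limit from the right is taken in the
        measure of the ball only.\<close>
      have *: "?F r \<le> S * ?V s" if "r < s" for s
      proof -
        obtain q where q: "q \<in> \<rat>" "r < q" "q < s" using Rats_dense_in_real[of r s] \<open>r < s\<close> by auto
        have Vq: "0 < ?V q" using r V_mono[of r q] q by auto
        have "?F q / ?V q \<le> S"
          unfolding S_def by (rule SUP_upper2[of q]) (use q r Vq in auto)
        then have "?F q / ?V q * ?V q \<le> S * ?V q" by (rule mult_right_mono) simp
        moreover have "?F q / ?V q * ?V q = ?F q"
          using Vq fin[of q] by (simp add: ennreal_divide_times less_top)
        ultimately have "?F q \<le> S * ?V q" by simp
        also have "\<dots> \<le> S * ?V s" using V_mono[of q s] q by (intro mult_left_mono) auto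
        finally show ?thesis using F_mono[of r q] q by simp
      qed
      let ?r = "\<lambda>n::nat. r + 1 / real (Suc n)"
      have lim_r: "?r \<longlonglongrightarrow> r"
        using tendsto_add[OF tendsto_const[of r] LIMSEQ_inverse_real_of_nat] by (simp add: inverse_eq_divide)
      have "(\<lambda>n. ?V (?r n)) \<longlonglongrightarrow> emeasure M (\<Inter>n. cball_Rd d x (?r n))"
      proof (rule Lim_emeasure_decseq)
        show "decseq (\<lambda>n. cball_Rd d x (?r n))"
          by (intro antimonoI cball_Rd_mono) (auto simp: frac_le)
      qed (use fin sets in \<open>auto simp: less_top\<close>)
      also have "(\<Inter>n. cball_Rd d x (?r n)) = cball_Rd d x r"
      proof (intro antisym subsetI)
        fix y assume y: "y \<in> (\<Inter>n. cball_Rd d x (?r n))"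
        then have "norm_Rd d (\<lambda>i. y i - x i) \<le> ?r n" for n by (auto simp: cball_Rd_def)
        then have "norm_Rd d (\<lambda>i. y i - x i) \<le> r" by (intro LIMSEQ_le_const[OF lim_r]) auto
        then show "y \<in> cball_Rd d x r" using y by (auto simp: cball_Rd_def)
      next
        fix y assume "y \<in> cball_Rd d x r"
        then show "y \<in> (\<Inter>n. cball_Rd d x (?r n))"
          using cball_Rd_mono[of r "?r _" d x] by auto
      qed
      finally have "(\<lambda>n. S * ?V (?r n)) \<longlonglongrightarrow> S * ?V r"
        using S by (intro ennreal_tendsto_cmult) auto
      moreover have "\<forall>n. ?F r \<le> S * ?V (?r n)" by (auto intro: *)
      ultimately have "?F r \<le> S * ?V r" by (intro LIMSEQ_le_const) auto
      then show ?thesis using r by (intro divide_le_posI_ennreal) (auto simp: mult.commute)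
    qed simp
    then show "?F r / ?V r \<le> ?S" by (simp only: S_def)
  qed
  show "?S \<le> maximal_function d M g x"
    unfolding maximal_function_def
    by (intro SUP_least) (auto intro!: SUP_upper)
qed

text \<open>
  For a fixed radius the means depend measurably on the centre, by Fubini; the supremum over
  rational radii is countable. Measurability matters because a non-measurable level set would
  have measure $0$ by convention, and lower bounds on level sets would be meaningless.
\<close>

lemma borel_measurable_maximal_function:
  assumes sets: "sets M = sets (lebesgue_Rd d)"
    and fin: "\<And>x r. emeasure M (cball_Rd d x r) < top"
    and g: "g \<in> borel_measurable M"
  shows "maximal_function d M g \<in> borel_measurable M"
proof -
  note [measurable] = g
  note [measurable_cong] = sets
  interpret sigma_finite_measure M
    by (rule sigma_finite_if_balls_finite[OF sets fin])
  have F: "(\<lambda>x. \<integral>\<^sup>+y. h y * indicator (cball_Rd d x q) y \<partial>M) \<in> borel_measurable M"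
    if [measurable]: "h \<in> borel_measurable M" for h :: "_ \<Rightarrow> ennreal" and q
  proof (rule borel_measurable_nn_integral)
    have c: "(\<lambda>p. fst p i) \<in> borel_measurable (M \<Otimes>\<^sub>M M)" "(\<lambda>p. snd p i) \<in> borel_measurable (M \<Otimes>\<^sub>M M)"
      if "i < d" for i
    proof -
      note [measurable] = measurable_coord[OF that]
      show "(\<lambda>p. fst p i) \<in> borel_measurable (M \<Otimes>\<^sub>M M)" "(\<lambda>p. snd p i) \<in> borel_measurable (M \<Otimes>\<^sub>M M)"
        by measurable
    qed
    have [measurable]: "(\<lambda>p. norm_Rd d (\<lambda>i. snd p i - fst p i)) \<in> borel_measurable (M \<Otimes>\<^sub>M M)"
      using c by (intro measurable_norm_Rd borel_measurable_diff) auto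
    have "(\<lambda>p. h (snd p) * indicator {p \<in> space (M \<Otimes>\<^sub>M M). norm_Rd d (\<lambda>i. snd p i - fst p i) \<le> q} p)
        \<in> borel_measurable (M \<Otimes>\<^sub>M M)" by measurable
    then show "(\<lambda>(x, y). h y * indicator (cball_Rd d x q) y) \<in> borel_measurable (M \<Otimes>\<^sub>M M)"
      by (rule measurable_cong[THEN iffD1, rotated])
         (auto simp: indicator_def cball_Rd_def space_pair_measure sets_eq_imp_space_eq[OF sets])
  qed
  have V: "(\<lambda>x. emeasure M (cball_Rd d x q)) \<in> borel_measurable M" for q
  proof -
    have "emeasure M (cball_Rd d x q) = (\<integral>\<^sup>+y. 1 * indicator (cball_Rd d x q) y \<partial>M)" for x
      by (simp add: sets)
    then show ?thesis using F[of "\<lambda>_. 1" q] by simp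
  qed
  note [measurable] = V F
  have "(\<lambda>x. SUP q\<in>{q\<in>\<rat>. 0 < q}. if 0 < emeasure M (cball_Rd d x q) then
       (\<integral>\<^sup>+y\<in>cball_Rd d x q. ennreal \<bar>g y\<bar> \<partial>M) / emeasure M (cball_Rd d x q) else 0) \<in> borel_measurable M"
    by (intro borel_measurable_SUP) (auto intro: countable_subset[OF _ countable_rat])
  then show ?thesis
    by (subst measurable_cong) (rule maximal_function_eq_SUP_rat[OF sets fin])
qed

section \<open>Strong type implies weak type\<close>

lemma ennreal_powr_ennreal: "0 \<le> a \<Longrightarrow> ennreal_powr (ennreal a) p = ennreal (a powr p)"
  by (simp add: ennreal_powr_def)

lemma ennreal_powr_mono: "a \<le> b \<Longrightarrow> 0 \<le> p \<Longrightarrow> ennreal_powr a p \<le> ennreal_powr b p"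
  by (cases a; cases b)
     (auto simp: ennreal_powr_ennreal ennreal_powr_def top_unique intro!: ennreal_leI powr_mono2)

lemma ennreal_powr_root: "0 < p \<Longrightarrow> ennreal_powr (ennreal_powr a (1 / p)) p = a"
  by (cases a) (auto simp: ennreal_powr_ennreal powr_powr, simp add: ennreal_powr_def)

text \<open>
  This is the Markov inequality for $(Mg)^p$. The integral over $[0,\infty]$ is a supremum over
  simple functions below the integrand, so the argument does not depend on measurability of
  $Mg$: if the level set is not measurable, its measure is $0$ by convention.
\<close>

lemma strong_type_imp_weak_type:
  assumes p: "0 < p" and C: "C < top" and strong: "strong_type p d M C"
  shows "weak_type p d M C"
  unfolding weak_type_def
proof (intro ballI allI impI)
  fix g and \<alpha> :: real assume g: "g \<in> Lp_space p M" and \<alpha>: "0 < \<alpha>"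
  let ?f = "maximal_function d M g" and ?N = "Lp_norm p M (\<lambda>x. ennreal \<bar>g x\<bar>)"
  let ?S = "{x \<in> space M. ennreal \<alpha> \<le> ?f x}" and ?I = "\<integral>\<^sup>+x. ennreal_powr (?f x) p \<partial>M"
  have "C * ?N < top" using g C by (simp add: Lp_space_def ennreal_mult_less_top)
  then obtain k where k: "0 \<le> k" "C * ?N = ennreal k" by (cases "C * ?N") auto
  have "ennreal_powr ?I (1 / p) \<le> ennreal k"
    using strong g k unfolding strong_type_def Lp_norm_def by auto
  then have "ennreal_powr (ennreal_powr ?I (1 / p)) p \<le> ennreal_powr (ennreal k) p"
    using p by (intro ennreal_powr_mono) auto
  then have I: "?I \<le> ennreal (k powr p)" using p k by (simp add: ennreal_powr_root ennreal_powr_ennreal)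
  show "emeasure M ?S \<le> ennreal_powr (C * ?N / ennreal \<alpha>) p"
  proof (cases "?S \<in> sets M")
    case True
    have "ennreal (\<alpha> powr p) * emeasure M ?S = (\<integral>\<^sup>+x. ennreal (\<alpha> powr p) * indicator ?S x \<partial>M)"
      using True by (simp add: nn_integral_cmult_indicator)
    also have "\<dots> \<le> ?I"
    proof (rule nn_integral_mono)
      fix x
      have "ennreal (\<alpha> powr p) \<le> ennreal_powr (?f x) p" if "ennreal \<alpha> \<le> ?f x"
        using ennreal_powr_mono[OF that, of p] p \<alpha> by (simp add: ennreal_powr_ennreal)
      then show "ennreal (\<alpha> powr p) * indicator ?S x \<le> ennreal_powr (?f x) p"
        by (auto simp: indicator_def)
    qed
    finally have "ennreal (\<alpha> powr p) * emeasure M ?S \<le> ennreal (k powr p)" using I by simp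
    then have "ennreal (\<alpha> powr p) * emeasure M ?S / ennreal (\<alpha> powr p) \<le> ennreal (k powr p) / ennreal (\<alpha> powr p)"
      by (rule divide_right_mono_ennreal)
    then show ?thesis using \<alpha> k
      by (simp add: divide_ennreal ennreal_powr_ennreal powr_divide mult.commute[of "ennreal _"] ennreal_mult_divide_eq)
  qed (simp add: emeasure_notin_sets)
qed

lemma weak_const_le_strong_const: "0 < p \<Longrightarrow> weak_const p d t \<le> strong_const p d t"
  unfolding weak_const_def strong_const_def
  by (intro Inf_superset_mono) (auto intro: strong_type_imp_weak_type)

section \<open>The maximal function of the unit ball\<close>

text \<open>
  If $|y| \le 1$ and $\langle x,y\rangle \ge 0$, then $|y-x|^2 \le 1+|x|^2$. One of $y$ and $-y$
  always satisfies the second condition, and the measure is invariant under reflection.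
\<close>

lemma half_unit_ball_in_off_centre_ball:
  "emeasure (mu t d) (cball0 d 1) \<le> 2 * emeasure (mu t d)
     (cball_Rd d x (sqrt (1 + (norm_Rd d x)^2)) \<inter> cball0 d 1)"
proof -
  let ?E = "cball_Rd d x (sqrt (1 + (norm_Rd d x)^2)) \<inter> cball0 d 1"
  let ?E' = "{y \<in> space (lebesgue_Rd d). (\<lambda>i\<in>{..<d}. (-1) * y i) \<in> ?E}"
  have [measurable]: "(\<lambda>y. \<lambda>i\<in>{..<d}. (-1) * y i) \<in> measurable (lebesgue_Rd d) (lebesgue_Rd d)"
    using measurable_affine_Rd[where v = "\<lambda>_. 0" and c = "-1" and d = d] by simp
  have E: "?E \<in> sets (lebesgue_Rd d)" by measurable
  have E': "?E' \<in> sets (lebesgue_Rd d)" by measurable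
  have eq: "emeasure (mu t d) ?E' = emeasure (mu t d) ?E"
    using emeasure_mu_scale[OF _ E, of "-1" t] by simp
  have near: "norm_Rd d (\<lambda>i. z i - x i) \<le> sqrt (1 + (norm_Rd d x)^2)"
    if "norm_Rd d z \<le> 1" "0 \<le> (\<Sum>i<d. x i * z i)" for z
    using that power_le_one[of "norm_Rd d z" 2] by (intro real_le_rsqrt) (simp add: norm_Rd_diff_sq)
  have "cball0 d 1 \<subseteq> ?E \<union> ?E'"
  proof
    fix y assume y: "y \<in> cball0 d 1"
    then have ny: "norm_Rd d y \<le> 1" and ys: "y \<in> space (lebesgue_Rd d)" by (auto simp: cball_Rd_def)
    show "y \<in> ?E \<union> ?E'"
    proof (cases "0 \<le> (\<Sum>i<d. x i * y i)")
      case True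
      then show ?thesis using near[OF ny] y ys by (auto simp: cball_Rd_def)
    next
      case False
      let ?z = "\<lambda>i\<in>{..<d}. (-1) * y i"
      have nz: "norm_Rd d ?z \<le> 1" using ny norm_Rd_scale[of d "-1" y] by simp
      have "(\<Sum>i<d. x i * ?z i) = - (\<Sum>i<d. x i * y i)" by (simp add: sum_negf)
      then have "norm_Rd d (\<lambda>i. ?z i - x i) \<le> sqrt (1 + (norm_Rd d x)^2)"
        using False by (intro near[OF nz]) linarith
      then have "?z \<in> ?E" using nz by (auto simp: cball_Rd_def scaled_mem_space simp del: restrict_apply)
      then show ?thesis using ys by auto
    qed
  qed
  then have "emeasure (mu t d) (cball0 d 1) \<le> emeasure (mu t d) (?E \<union> ?E')"
    using E E' by (intro emeasure_mono) auto
  also have "\<dots> \<le> emeasure (mu t d) ?E + emeasure (mu t d) ?E'"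
    using E E' by (intro emeasure_subadditive) auto
  finally show ?thesis unfolding eq by (simp add: mult_2)
qed

text \<open>
  The part of the ball within distance $2$ of the origin has measure at most
  $2^{(1-t)d}\mu(B(0,1))$. The rest is translated towards the origin by
  a multiple of $x$ into $B(0,3R)$, whose measure is $(3R)^{(1-t)d}\mu(B(0,1))$; the
  last hypothesis says that the factor won by the translation compensates for this
  growth.
\<close>

lemma off_centre_ball_small:
  assumes t: "0 < t" "t < 1" and xR: "norm_Rd d x \<le> R" and R: "1 \<le> R"
    and q: "sqrt (1 - 1 / (2 * R^2)) powr (t * real d) * (3 * R) powr ((1 - t) * real d) \<le> 1"
  shows "emeasure (mu t d) (cball_Rd d x (sqrt (1 + (norm_Rd d x)^2)))
    \<le> ennreal (2 * 2 powr ((1 - t) * real d)) * emeasure (mu t d) (cball0 d 1)"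
proof -
  define E where "E = cball_Rd d x (sqrt (1 + (norm_Rd d x)^2))"
  define F where "F = {y \<in> E. 2 \<le> norm_Rd d y}"
  define s where "s = (if norm_Rd d x \<le> 1 then 1 else 1 / (norm_Rd d x)^2)"
  let ?q = "sqrt (1 - 1 / (2 * R^2))" and ?D = "(1 - t) * real d"
  let ?m = "emeasure (mu t d) (cball0 d 1)"
  have E [measurable]: "E \<in> sets (lebesgue_Rd d)" by (simp add: E_def)
  have "F = {y \<in> space (lebesgue_Rd d). y \<in> E \<and> 2 \<le> norm_Rd d y}"
    using sets.sets_into_space[OF E] by (auto simp: F_def)
  then have F [measurable]: "F \<in> sets (lebesgue_Rd d)" by simp
  have "1 \<le> R^2" using R by (rule one_le_power)
  then have "1 / (2 * R^2) \<le> 1 / 2" by (intro divide_left_mono) auto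
  then have q0: "0 < ?q" and q1: "?q \<le> 1" by simp_all
  have far: "norm_Rd d (\<lambda>i. y i - s * x i) \<le> ?q * norm_Rd d y"
    "0 < norm_Rd d (\<lambda>i. y i - s * x i)" "norm_Rd d (\<lambda>i. y i - s * x i) \<le> 3 * R" if "y \<in> F" for y
  proof -
    have ball: "norm_Rd d (\<lambda>i. y i - x i) \<le> sqrt (1 + (norm_Rd d x)^2)" and y2: "2 \<le> norm_Rd d y"
      using that by (auto simp: F_def E_def cball_Rd_def)
    note sh = shift_contracts_off_centre[OF ball y2 xR R, folded s_def]
    show c: "norm_Rd d (\<lambda>i. y i - s * x i) \<le> ?q * norm_Rd d y" by (rule sh)
    have "norm_Rd d (\<lambda>i. s * x i) \<le> 1" using sh(2,3) by (simp add: norm_Rd_scale)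
    then show "0 < norm_Rd d (\<lambda>i. y i - s * x i)"
      using norm_Rd_le_diff_add[of d y "\<lambda>i. s * x i"] y2 by simp
    have "sqrt (1 + (norm_Rd d x)^2) \<le> 1 + norm_Rd d x"
      by (rule real_le_lsqrt) (auto simp: power2_eq_square algebra_simps)
    then have "norm_Rd d y \<le> 3 * R"
      using norm_Rd_le_diff_add[of d y x] ball xR R by simp
    moreover have "?q * norm_Rd d y \<le> 1 * norm_Rd d y" using q1 by (intro mult_right_mono) auto
    ultimately show "norm_Rd d (\<lambda>i. y i - s * x i) \<le> 3 * R" using c by simp
  qed
  have "emeasure (mu t d) F \<le> ennreal (?q powr (t * real d)) * emeasure (mu t d) (cball0 d (3 * R))"
    by (rule emeasure_mu_translate_le[OF t(1) F q0 far])
  also have "\<dots> = ennreal (?q powr (t * real d) * (3 * R) powr ?D) * ?m"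
    using R emeasure_mu_cball0[of "3 * R" t d] by (simp add: ennreal_mult' mult.assoc)
  also have "\<dots> \<le> ennreal 1 * ?m" using q by (intro mult_right_mono ennreal_leI) auto
  finally have F_le: "emeasure (mu t d) F \<le> ?m" by simp
  have "E \<subseteq> cball0 d 2 \<union> F" by (auto simp: F_def E_def cball_Rd_def)
  then have "emeasure (mu t d) E \<le> emeasure (mu t d) (cball0 d 2 \<union> F)"
    by (intro emeasure_mono) auto
  also have "\<dots> \<le> emeasure (mu t d) (cball0 d 2) + emeasure (mu t d) F"
    by (intro emeasure_subadditive) auto
  also have "\<dots> \<le> ennreal (2 powr ?D) * ?m + 1 * ?m"
    using F_le emeasure_mu_cball0[of 2 t d] by (intro add_mono) auto
  also have "\<dots> = (ennreal (2 powr ?D) + ennreal 1) * ?m" by (simp add: distrib_right)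
  also have "\<dots> = ennreal (2 powr ?D + 1) * ?m" by (subst ennreal_plus) auto
  also have "\<dots> \<le> ennreal (2 * 2 powr ?D) * ?m"
    using t by (intro mult_right_mono ennreal_leI) (auto simp: ge_one_powr_ge_zero)
  finally show ?thesis by (simp add: E_def)
qed

lemma maximal_function_unit_ball_ge:
  assumes d: "0 < d" and t: "0 < t" "t < 1" and xR: "norm_Rd d x \<le> R" and R: "1 \<le> R"
    and q: "sqrt (1 - 1 / (2 * R^2)) powr (t * real d) * (3 * R) powr ((1 - t) * real d) \<le> 1"
  shows "ennreal (2 powr (- ((1 - t) * real d)) / 4)
    \<le> maximal_function d (mu t d) (indicator (cball0 d 1)) x"
proof -
  let ?M = "mu t d" and ?r = "sqrt (1 + (norm_Rd d x)^2)" and ?D = "(1 - t) * real d"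
  let ?E = "cball_Rd d x ?r" and ?B = "cball0 d 1"
  have m_fin: "emeasure ?M ?B < top" by (rule emeasure_mu_unit_ball_finite[OF d t])
  have m_pos: "0 < emeasure ?M ?B" by (rule emeasure_mu_unit_ball_pos[OF d t(1)])
  obtain m where m: "emeasure ?M ?B = ennreal m" "0 < m"
    using m_fin m_pos by (cases "emeasure ?M ?B") auto
  obtain e where e: "emeasure ?M ?E = ennreal e" "0 \<le> e"
    using emeasure_mu_cball_finite[OF d t, of x ?r] by (cases "emeasure ?M ?E") auto
  have "emeasure ?M (?E \<inter> ?B) \<le> emeasure ?M ?E" by (intro emeasure_mono) auto
  then obtain n where n: "emeasure ?M (?E \<inter> ?B) = ennreal n" "0 \<le> n"
    using e by (cases "emeasure ?M (?E \<inter> ?B)") (auto simp: top_unique)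
  have ne: "n \<le> e" using \<open>emeasure ?M (?E \<inter> ?B) \<le> emeasure ?M ?E\<close> n e by simp
  have mn: "m \<le> 2 * n"
  proof -
    have "ennreal m \<le> ennreal (2 * n)"
      using half_unit_ball_in_off_centre_ball[of t d x] m n by (simp add: ennreal_mult')
    then show ?thesis using n by simp
  qed
  have em: "e \<le> 2 * 2 powr ?D * m"
  proof -
    have "ennreal e \<le> ennreal (2 * 2 powr ?D * m)"
      using off_centre_ball_small[OF t xR R q] m e by (simp add: ennreal_mult')
    then show ?thesis using m by simp
  qed
  have e_pos: "0 < e" using mn ne m by simp
  have "2 powr (- ?D) / 4 \<le> n / e"
  proof -
    have "2 powr (- ?D) * e \<le> 2 powr (- ?D) * (2 * 2 powr ?D * m)" using em by (intro mult_left_mono) auto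
    also have "\<dots> = 2 * m" by (simp add: powr_minus)
    also have "\<dots> \<le> 4 * n" using mn by simp
    finally show ?thesis using e_pos by (simp add: field_simps)
  qed
  then have "ennreal (2 powr (- ?D) / 4) \<le> ennreal n / ennreal e"
    using n e_pos by (simp add: divide_ennreal)
  also have "ennreal n = (\<integral>\<^sup>+y\<in>?E. ennreal \<bar>indicator ?B y\<bar> \<partial>?M)"
  proof -
    have "(\<integral>\<^sup>+y\<in>?E. ennreal \<bar>indicator ?B y\<bar> \<partial>?M) = (\<integral>\<^sup>+y. indicator (?E \<inter> ?B) y \<partial>?M)"
      by (intro nn_integral_cong) (auto simp: indicator_def)
    then show ?thesis using n by simp
  qed
  also have "(\<integral>\<^sup>+y\<in>?E. ennreal \<bar>indicator ?B y\<bar> \<partial>?M) / ennreal e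
      \<le> maximal_function d ?M (indicator ?B) x"
    unfolding maximal_function_def
    by (rule SUP_upper2[of ?r]) (use e e_pos in \<open>auto simp: add_pos_nonneg\<close>)
  finally show ?thesis .
qed

lemma Lp_norm_indicator:
  assumes "A \<in> sets M" "0 < p"
  shows "Lp_norm p M (\<lambda>x. ennreal \<bar>indicator A x\<bar>) = ennreal_powr (emeasure M A) (1 / p)"
proof -
  have "ennreal_powr (ennreal \<bar>indicator A x\<bar>) p = indicator A x" for x
    using assms(2) by (auto simp: indicator_def ennreal_powr_def)
  then show ?thesis using assms(1) by (simp add: Lp_norm_def)
qed

text \<open>
  Every point of $B(0,R)$ lies in the level set of height $\alpha = 2^{-D}/4$, where $D=(1-t)d$, so
  the weak type inequality for the indicator of the unit ball gives $R^D \le (c/\alpha)^p$.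
  The radius $R = 4^{p_0}$ is chosen such that $R^{D/p} \ge 4^D$, which outweighs the loss
  $2^{-D}$ in the height.
\<close>

lemma weak_type_constant_ge:
  assumes d: "0 < d" and t: "0 < t" "t < 1" and p: "1 \<le> p" "p \<le> p0"
    and q: "sqrt (1 - 1 / (2 * (4 powr p0)^2)) powr (t * real d) * (3 * 4 powr p0) powr ((1 - t) * real d) \<le> 1"
    and c: "c < top" "weak_type p d (mu t d) c"
  shows "ennreal (2 powr ((1 - t) * real d) / 4) \<le> c"
proof -
  let ?M = "mu t d" and ?D = "(1 - t) * real d" and ?R = "4 powr p0"
  let ?B = "cball0 d 1" and ?g = "indicator (cball0 d 1) :: _ \<Rightarrow> real"
  define \<alpha> where "\<alpha> = 2 powr (- ?D) / 4"
  have \<alpha>: "0 < \<alpha>" by (simp add: \<alpha>_def)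
  have R: "1 \<le> ?R" using p by (intro ge_one_powr_ge_zero) auto
  have D: "0 \<le> ?D" using t by simp
  obtain m where m: "emeasure ?M ?B = ennreal m" "0 < m"
    using emeasure_mu_unit_ball_finite[OF d t] emeasure_mu_unit_ball_pos[OF d t(1)]
    by (cases "emeasure ?M ?B") auto
  obtain k where k: "c = ennreal k" "0 \<le> k" using c by (cases c) auto
  have norm_g: "Lp_norm p ?M (\<lambda>x. ennreal \<bar>?g x\<bar>) = ennreal (m powr (1 / p))"
    using p m by (subst Lp_norm_indicator) (auto simp: ennreal_powr_ennreal)
  have g_meas: "?g \<in> borel_measurable ?M" by measurable
  then have g: "?g \<in> Lp_space p ?M" using norm_g by (simp add: Lp_space_def)
  have [measurable]: "maximal_function d ?M ?g \<in> borel_measurable ?M"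
    by (rule borel_measurable_maximal_function[OF sets_mu emeasure_mu_cball_finite[OF d t] g_meas])
  have "ennreal (?R powr ?D * m) = emeasure ?M (cball0 d ?R)"
    using emeasure_mu_cball0[of ?R t d] m R by (simp add: ennreal_mult')
  also have "\<dots> \<le> emeasure ?M {x \<in> space ?M. ennreal \<alpha> \<le> maximal_function d ?M ?g x}"
  proof (rule emeasure_mono)
    show "cball0 d ?R \<subseteq> {x \<in> space ?M. ennreal \<alpha> \<le> maximal_function d ?M ?g x}"
    proof
      fix x assume "x \<in> cball0 d ?R"
      then have "x \<in> space ?M" "norm_Rd d x \<le> ?R" by (simp_all add: cball_Rd_def)
      then show "x \<in> {x \<in> space ?M. ennreal \<alpha> \<le> maximal_function d ?M ?g x}"
        using maximal_function_unit_ball_ge[OF d t _ R q, of x] unfolding \<alpha>_def by blast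
    qed
    show "{x \<in> space ?M. ennreal \<alpha> \<le> maximal_function d ?M ?g x} \<in> sets ?M" by measurable
  qed
  also have "\<dots> \<le> ennreal_powr (c * Lp_norm p ?M (\<lambda>x. ennreal \<bar>?g x\<bar>) / ennreal \<alpha>) p"
    using c(2) g \<alpha> unfolding weak_type_def by blast
  also have "c * Lp_norm p ?M (\<lambda>x. ennreal \<bar>?g x\<bar>) / ennreal \<alpha> = ennreal (k / \<alpha> * m powr (1 / p))"
    unfolding norm_g using k \<alpha> by (simp add: ennreal_mult'[symmetric] divide_ennreal)
  also have "ennreal_powr \<dots> p = ennreal ((k / \<alpha>) powr p * m)"
    using k \<alpha> m p by (simp add: ennreal_powr_ennreal powr_mult powr_divide powr_powr)
  finally have "?R powr ?D * m \<le> (k / \<alpha>) powr p * m" using m by simp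
  then have "?R powr ?D \<le> (k / \<alpha>) powr p" using m by simp
  then have "(?R powr ?D) powr (1 / p) \<le> ((k / \<alpha>) powr p) powr (1 / p)"
    using p by (intro powr_mono2) auto
  then have 1: "4 powr (p0 / p * ?D) \<le> k / \<alpha>"
    using p k \<alpha> by (simp add: powr_powr)
  have "1 * ?D \<le> p0 / p * ?D" using p D by (intro mult_right_mono) auto
  then have "4 powr ?D \<le> 4 powr (p0 / p * ?D)" by (intro powr_mono) auto
  with 1 have "4 powr ?D \<le> k / \<alpha>" by linarith
  then have "4 powr ?D * \<alpha> \<le> k" using \<alpha> by (simp only: pos_le_divide_eq)
  moreover have "4 powr ?D = 2 powr ?D * 2 powr ?D" using powr_mult[of 2 2 ?D] by simp
  then have "4 powr ?D * \<alpha> = 2 powr ?D / 4" by (simp add: \<alpha>_def powr_minus)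
  ultimately show ?thesis using k by (simp add: ennreal_leI)
qed

text \<open>
  Both factors are powers with the common exponent $x$ of $q^t K^{1-t}$, a number that
  tends to $q < 1$ as $t \to 1$; this is why one threshold serves all dimensions. The threshold
  solves $q^t K^{1-t} = 1$.
\<close>

lemma exists_uniform_t0:
  fixes q K :: real
  assumes q: "0 < q" "q < 1" and K: "1 < K"
  obtains t0 where "0 < t0" "t0 < 1"
    "\<And>t x. t0 \<le> t \<Longrightarrow> t < 1 \<Longrightarrow> 0 \<le> x \<Longrightarrow> q powr (t * x) * K powr ((1 - t) * x) \<le> 1"
proof -
  let ?a = "- ln q" and ?b = "ln K"
  have a: "0 < ?a" and b: "0 < ?b" using q K by auto
  show ?thesis
  proof (rule that[of "?b / (?a + ?b)"])
    show "0 < ?b / (?a + ?b)" "?b / (?a + ?b) < 1" using a b by (auto simp: field_simps)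
    fix t x :: real assume t: "?b / (?a + ?b) \<le> t" "t < 1" and x: "0 \<le> x"
    have "?b \<le> t * (?a + ?b)" using t a b by (simp add: pos_divide_le_eq)
    then have "t * ln q + (1 - t) * ln K \<le> 0" by (simp add: algebra_simps)
    then have "x * (t * ln q + (1 - t) * ln K) \<le> 0" using x by (simp add: mult_nonneg_nonpos)
    moreover have "q powr (t * x) * K powr ((1 - t) * x) = exp (x * (t * ln q + (1 - t) * ln K))"
      using q K by (simp add: powr_def exp_add[symmetric] algebra_simps)
    ultimately show "q powr (t * x) * K powr ((1 - t) * x) \<le> 1" by simp
  qed
qed

section \<open>The lower bound for the constants\<close>

theorem theorem3p12:
  fixes p0 :: real
  assumes "1 \<le> p0"
  shows "\<exists>t0 b0 :: real. 0 < t0 \<and> t0 < 1 \<and> 1 < b0 \<and>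
    (\<forall>(p::real) (t::real) (d::nat). 1 \<le> p \<and> p \<le> p0 \<and> t0 \<le> t \<and> t < 1 \<and> d \<noteq> 0 \<longrightarrow>
       strong_const p d t \<ge> weak_const p d t \<and>
       weak_const p d t \<ge> ennreal (b0 powr ((1 - t) * real d) / 6))"
proof -
  let ?R = "4 powr p0"
  have R: "1 \<le> ?R" using assms by (intro ge_one_powr_ge_zero) auto
  have "1 \<le> ?R^2" using R by (rule one_le_power)
  then have "1 / (2 * ?R^2) \<le> 1 / 2" by (intro divide_left_mono) auto
  then have q: "0 < sqrt (1 - 1 / (2 * ?R^2))" "sqrt (1 - 1 / (2 * ?R^2)) < 1"
    by simp_all
  have "1 < 3 * ?R" using R by simp
  from exists_uniform_t0[OF q this] obtain t0 where t0: "0 < t0" "t0 < 1"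
    and small: "\<And>t x. t0 \<le> t \<Longrightarrow> t < 1 \<Longrightarrow> 0 \<le> x \<Longrightarrow>
      sqrt (1 - 1 / (2 * ?R^2)) powr (t * x) * (3 * ?R) powr ((1 - t) * x) \<le> 1"
    by blast
  have "strong_const p d t \<ge> weak_const p d t \<and> weak_const p d t \<ge> ennreal (2 powr ((1 - t) * real d) / 6)"
    if "1 \<le> p" "p \<le> p0" "t0 \<le> t" "t < 1" "d \<noteq> 0" for p t d
  proof
    show "weak_const p d t \<le> strong_const p d t"
      using that by (intro weak_const_le_strong_const) simp
    have "ennreal (2 powr ((1 - t) * real d) / 6) \<le> c" if c: "c < top" "weak_type p d (mu t d) c" for c
    proof -
      have "ennreal (2 powr ((1 - t) * real d) / 6) \<le> ennreal (2 powr ((1 - t) * real d) / 4)"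
        by (intro ennreal_leI) simp
      also have "\<dots> \<le> c"
        using \<open>d \<noteq> 0\<close> \<open>t0 \<le> t\<close> \<open>t < 1\<close> \<open>1 \<le> p\<close> \<open>p \<le> p0\<close> t0
        by (intro weak_type_constant_ge[OF _ _ _ _ _ small c]) auto
      finally show ?thesis .
    qed
    then show "ennreal (2 powr ((1 - t) * real d) / 6) \<le> weak_const p d t"
      unfolding weak_const_def by (intro Inf_greatest) auto
  qed
  with t0 show ?thesis by (intro exI[of _ t0] exI[of _ 2]) auto
qed

end
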